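(* Let $n,m$ be positive integers, $A\in\mathbb{R}^{n\times n}$ symmetric positive semidefinite, $b\in\mathbb{R}^n$, $c\in\mathbb{R}$, $B\in\mathbb{R}^{n\times m}$, $u\in\mathbb{R}^m$, $\gamma>0$, and let $f(x)=\tfrac12\langle x,Ax\rangle+\langle b,x\rangle+c$ for $x\in\mathbb{R}^n$. Then for every $z\in\mathbb{R}^n$ the controlled proximity operator is given by the controlled resolvent: $$\operatorname*{argmin}_{x\in\mathbb{R}^n}\Big\{f(x)+\frac{1}{2\gamma}\|x-z\|^2-\langle Bu,x\rangle\Big\}=\Big\{(\mathrm{Id}+\gamma\nabla f)^{-1}\big(z+\gamma Bu\big)\Big\}.$$
   Context: $\langle\cdot,\cdot\rangle$ and $\|\cdot\|$ are the Euclidean scalar product and norm on $\mathbb{R}^n$, and $\nabla f(x)=Ax+b$. The controlled proximity operator of $f$ with parameter $\gamma$ and control $u$ maps $z$ to the set of minimizers on the left-hand side. The controlled resolvent is the map $z\mapsto(\mathrm{Id}+\gamma\nabla f)^{-1}(\psi_u(z))$ with $\psi_u(z)=z+\gamma Bu$, where $(\mathrm{Id}+\gamma\nabla f)^{-1}$ denotes the inverse of the map $x\mapsto x+\gamma\nabla f(x)$ on $\mathbb{R}^n$. *)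

theory Defs
  imports "HOL-Analysis.Analysis"
begin

definition sym_pos_semidef :: "real ^ 'n ^ 'n \<Rightarrow> bool" where
  "sym_pos_semidef A \<longleftrightarrow> transpose A = A \<and> (\<forall>x. 0 \<le> x \<bullet> (A *v x))"

(* Unspecified at points where F is not differentiable. *)
definition gradient :: "('a::real_inner \<Rightarrow> real) \<Rightarrow> 'a \<Rightarrow> 'a" where
  "gradient F x = (THE D. GDERIV F x :> D)"

definition argmin_set :: "('a \<Rightarrow> real) \<Rightarrow> 'a set" where
  "argmin_set F = {x. is_arg_min F (\<lambda>_. True) x}"

definition controlled_prox ::
  "(real ^ 'n \<Rightarrow> real) \<Rightarrow> real ^ 'm ^ 'n \<Rightarrow> real \<Rightarrow> real ^ 'm \<Rightarrow> real ^ 'n \<Rightarrow> (real ^ 'n) set" where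
  "controlled_prox f B \<gamma> u z =
     argmin_set (\<lambda>x. f x + 1 / (2 * \<gamma>) * (norm (x - z))\<^sup>2 - (B *v u) \<bullet> x)"

definition control_shift ::
  "real ^ 'm ^ 'n \<Rightarrow> real \<Rightarrow> real ^ 'm \<Rightarrow> real ^ 'n \<Rightarrow> real ^ 'n" where
  "control_shift B \<gamma> u z = z + \<gamma> *\<^sub>R (B *v u)"

definition forward_map :: "(real ^ 'n \<Rightarrow> real) \<Rightarrow> real \<Rightarrow> real ^ 'n \<Rightarrow> real ^ 'n" where
  "forward_map f \<gamma> x = x + \<gamma> *\<^sub>R gradient f x"

(* Meaningful only where forward_map f \<gamma> is bijective: otherwise inv is an arbitrary
   choice of preimages. *)
definition controlled_resolvent ::
  "(real ^ 'n \<Rightarrow> real) \<Rightarrow> real ^ 'm ^ 'n \<Rightarrow> real \<Rightarrow> real ^ 'm \<Rightarrow> real ^ 'n \<Rightarrow> real ^ 'n" where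
  "controlled_resolvent f B \<gamma> u z = inv (forward_map f \<gamma>) (control_shift B \<gamma> u z)"

end

theory Submission
  imports Defs
begin

text \<open>For quadratic \<open>f\<close> the map \<open>Id + \<gamma> \<nabla>f\<close> is affine, and its linear part \<open>Id + \<gamma>A\<close> satisfies
  \<open>\<langle>x, (Id + \<gamma>A) x\<rangle> \<ge> \<parallel>x\<parallel>\<^sup>2\<close>; it is therefore injective and, in finite dimension, bijective.
  If \<open>p\<close> is the preimage of \<open>z + \<gamma>Bu\<close>, the objective \<open>F\<close> has no first-order term at \<open>p\<close>, so that
  \<open>F x - F p = \<langle>x - p, A (x - p)\<rangle> / 2 + \<parallel>x - p\<parallel>\<^sup>2 / (2\<gamma>)\<close>, which is positive for \<open>x \<noteq> p\<close>.\<close>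

text \<open>The Frechet derivative at a point is unique, and a vector is determined by its inner
  products with all \<open>h\<close>; hence the definite description in \<open>gradient\<close>
  picks out \<open>D\<close>.\<close>

lemma gradient_eqI:
  assumes "GDERIV F x :> D"
  shows "gradient F x = D"
  unfolding gradient_def
proof (rule the_equality)
  fix D' assume "GDERIV F x :> D'"
  with assms have "(\<lambda>h. h \<bullet> D') = (\<lambda>h. h \<bullet> D)"
    unfolding gderiv_def using has_derivative_unique by blast
  then show "D' = D"
    by (simp add: fun_eq_iff vector_eq_ldot)
qed (fact assms)

lemma inner_matrix_vector_symmetric:
  fixes A :: "real ^ 'n ^ 'n"
  assumes "transpose A = A"
  shows "x \<bullet> (A *v y) = y \<bullet> (A *v x)"
proof -
  have "x \<bullet> (A *v y) = (transpose A *v x) \<bullet> y"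
    by (simp only: transpose_matrix_vector dot_lmul_matrix)
  then show ?thesis
    by (simp only: assms inner_commute)
qed

lemma gradient_quadratic:
  fixes A :: "real ^ 'n ^ 'n"
  assumes "transpose A = A"
  shows "gradient (\<lambda>x. 1 / 2 * (x \<bullet> (A *v x)) + b \<bullet> x + c) x = A *v x + b"
proof (rule gradient_eqI)
  have [derivative_intros]: "((*v) A has_derivative (*v) A) (at x)"
    by (simp add: bounded_linear_imp_has_derivative)
  have "((\<lambda>x. 1 / 2 * (x \<bullet> (A *v x)) + b \<bullet> x + c) has_derivative
      (\<lambda>h. 1 / 2 * (x \<bullet> (A *v h) + h \<bullet> (A *v x)) + b \<bullet> h)) (at x)"
    by (auto intro!: derivative_eq_intros)
  \<comment> \<open>The product rule yields two bilinear terms; symmetry of \<open>A\<close> makes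
    them equal, which absorbs the factor 1/2.\<close>
  moreover have "(\<lambda>h. 1 / 2 * (x \<bullet> (A *v h) + h \<bullet> (A *v x)) + b \<bullet> h) = (\<lambda>h. h \<bullet> (A *v x + b))"
    by (simp add: fun_eq_iff inner_matrix_vector_symmetric[OF assms, of x] inner_add_right
        inner_commute[of b])
  ultimately show "GDERIV (\<lambda>x. 1 / 2 * (x \<bullet> (A *v x)) + b \<bullet> x + c) x :> A *v x + b"
    by (simp add: gderiv_def)
qed

lemma bij_id_plus_pos_semidef_affine:
  fixes A :: "real ^ 'n ^ 'n"
  assumes "\<And>x. 0 \<le> x \<bullet> (A *v x)" and "0 \<le> \<gamma>"
  shows "bij (\<lambda>x. x + \<gamma> *\<^sub>R (A *v x + b))"
proof -
  define L where "L = (\<lambda>x. x + \<gamma> *\<^sub>R (A *v x))"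
  have lin: "linear L"
    unfolding L_def
    by (intro linear_compose_add linear_compose_scale_right matrix_vector_mul_linear linear_ident)
  have "x = 0" if "L x = 0" for x
  proof -
    have "x \<bullet> L x = x \<bullet> x + \<gamma> * (x \<bullet> (A *v x))"
      by (simp add: L_def inner_add_right)
    moreover have "0 \<le> \<gamma> * (x \<bullet> (A *v x))"
      using assms by simp
    ultimately have "x \<bullet> x \<le> 0"
      using that by simp
    then show "x = 0"
      by (meson inner_gt_zero_iff not_less)
  qed
  then have "inj L"
    using lin linear_injective_0 by blast
  with lin have "bij L"
    by (simp add: bij_def linear_injective_imp_surjective)
  \<comment> \<open>The constant term \<open>b\<close> only adds a translation after
    \<open>L\<close>, and translations are bijective.\<close>
  moreover have "(\<lambda>x. x + \<gamma> *\<^sub>R (A *v x + b)) = (\<lambda>y. y + \<gamma> *\<^sub>R b) \<circ> L"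
    by (simp add: fun_eq_iff L_def scaleR_add_right)
  moreover have "bij (\<lambda>y. y + \<gamma> *\<^sub>R b)"
    by (rule bij_betw_byWitness[where f' = "\<lambda>y. y - \<gamma> *\<^sub>R b"]) auto
  ultimately show ?thesis
    by (metis bij_comp)
qed

lemma argmin_set_eq_singletonI:
  assumes "\<And>x. x \<noteq> p \<Longrightarrow> F p < F x"
  shows "argmin_set F = {p}"
  using assms by (force simp: argmin_set_def is_arg_min_def)

text \<open>Assumption \<open>p\<close> is the stationarity condition
  \<open>A *v p + b + (p - z) /\<^sub>R \<gamma> = v\<close> multiplied by \<gamma>. Since
  \<open>F\<close> is quadratic, its expansion around \<open>p\<close> is exact, so no derivative of
  \<open>F\<close> has to be computed.\<close>

lemma proximal_objective_diff:
  fixes A :: "real ^ 'n ^ 'n" and b v z p x :: "real ^ 'n" and c \<gamma> :: real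
  defines "F \<equiv> \<lambda>x. 1 / 2 * (x \<bullet> (A *v x)) + b \<bullet> x + c
                  + 1 / (2 * \<gamma>) * (norm (x - z))\<^sup>2 - v \<bullet> x"
  assumes sym: "transpose A = A" and "\<gamma> \<noteq> 0"
    and p: "p + \<gamma> *\<^sub>R (A *v p + b) = z + \<gamma> *\<^sub>R v"
  shows "F x - F p = 1 / 2 * ((x - p) \<bullet> (A *v (x - p))) + 1 / (2 * \<gamma>) * (norm (x - p))\<^sup>2"
proof -
  define d where "d = x - p"
  have x: "x = p + d"
    by (simp add: d_def)
  have "d \<bullet> (p + \<gamma> *\<^sub>R (A *v p + b)) = d \<bullet> (z + \<gamma> *\<^sub>R v)"
    using p by simp
  \<comment> \<open>Pairing the condition on \<open>p\<close> with the displacement \<open>d\<close>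
    expresses \<open>d \<bullet> v\<close> through exactly those first-order terms that the other
    summands of \<open>F\<close> produce, so they cancel.\<close>
  then have stat: "d \<bullet> v = (d \<bullet> p - d \<bullet> z) / \<gamma> + d \<bullet> (A *v p) + d \<bullet> b"
    using \<open>\<gamma> \<noteq> 0\<close> by (simp add: inner_add_right field_simps)
  have quad: "x \<bullet> (A *v x) = p \<bullet> (A *v p) + 2 * (d \<bullet> (A *v p)) + d \<bullet> (A *v d)"
    using inner_matrix_vector_symmetric[OF sym, of p d]
    by (simp add: x matrix_vector_right_distrib inner_add_left inner_add_right)
  have "(norm (x - z))\<^sup>2 = (norm (d + (p - z)))\<^sup>2"
    by (simp add: x algebra_simps)
  also have "\<dots> = (norm d)\<^sup>2 + 2 * (d \<bullet> (p - z)) + (norm (p - z))\<^sup>2"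
    unfolding power2_norm_eq_inner inner_add_left inner_add_right inner_commute[of "p - z" d]
    by simp
  finally have nrm: "(norm (x - z))\<^sup>2 = (norm d)\<^sup>2 + 2 * (d \<bullet> p - d \<bullet> z) + (norm (p - z))\<^sup>2"
    by (simp add: inner_diff_right)
  have lin: "b \<bullet> x = b \<bullet> p + d \<bullet> b" "v \<bullet> x = v \<bullet> p + d \<bullet> v"
    by (simp_all add: x inner_add_right inner_commute[of _ d])
  have "F x - F p = 1 / 2 * (d \<bullet> (A *v d)) + 1 / (2 * \<gamma>) * (norm d)\<^sup>2"
    unfolding F_def quad nrm lin stat using \<open>\<gamma> \<noteq> 0\<close> by (simp add: field_simps)
  then show ?thesis
    by (simp add: d_def)
qed

theorem proposition4:
  fixes A :: "real ^ 'n ^ 'n" and b :: "real ^ 'n" and c :: real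
    and B :: "real ^ 'm ^ 'n" and u :: "real ^ 'm" and \<gamma> :: real
    and f :: "real ^ 'n \<Rightarrow> real"
  assumes "sym_pos_semidef A"
    and "\<gamma> > 0"
    and "\<And>x. f x = 1 / 2 * (x \<bullet> (A *v x)) + b \<bullet> x + c"
  shows "bij (forward_map f \<gamma>) \<and>
    (\<forall>z. controlled_prox f B \<gamma> u z = {controlled_resolvent f B \<gamma> u z})"
proof -
  have sym: "transpose A = A" and psd: "\<And>x. 0 \<le> x \<bullet> (A *v x)"
    using assms(1) by (auto simp: sym_pos_semidef_def)
  have f: "f = (\<lambda>x. 1 / 2 * (x \<bullet> (A *v x)) + b \<bullet> x + c)"
    using assms(3) by (simp add: fun_eq_iff)
  have fwd: "forward_map f \<gamma> = (\<lambda>x. x + \<gamma> *\<^sub>R (A *v x + b))"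
    by (simp only: fun_eq_iff forward_map_def f gradient_quadratic[OF sym] simp_thms)
  have bij: "bij (forward_map f \<gamma>)"
    unfolding fwd using psd assms(2) by (intro bij_id_plus_pos_semidef_affine) auto
  have "controlled_prox f B \<gamma> u z = {controlled_resolvent f B \<gamma> u z}" for z
  proof -
    define p where "p = controlled_resolvent f B \<gamma> u z"
    \<comment> \<open>Surjectivity makes \<open>inv\<close> a genuine right inverse, so
      \<open>p\<close> solves the resolvent equation.\<close>
    have "forward_map f \<gamma> p = control_shift B \<gamma> u z"
      unfolding p_def controlled_resolvent_def
      using bij by (simp add: bij_is_surj surj_f_inv_f)
    then have "p + \<gamma> *\<^sub>R (A *v p + b) = z + \<gamma> *\<^sub>R (B *v u)"
      by (simp add: fwd control_shift_def)
    note diff = proximal_objective_diff[OF sym _ this, where c = c]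
    have "controlled_prox f B \<gamma> u z = {p}"
      unfolding controlled_prox_def f
    proof (rule argmin_set_eq_singletonI)
      fix x assume "x \<noteq> p"
      \<comment> \<open>Strictness, and with it uniqueness, comes from the proximal term: the form
        of \<open>A\<close> may vanish at \<open>x - p\<close>.\<close>
      then have "0 < 1 / (2 * \<gamma>) * (norm (x - p))\<^sup>2"
        using assms(2) by simp
      then show "1 / 2 * (p \<bullet> (A *v p)) + b \<bullet> p + c + 1 / (2 * \<gamma>) * (norm (p - z))\<^sup>2 - (B *v u) \<bullet> p
          < 1 / 2 * (x \<bullet> (A *v x)) + b \<bullet> x + c + 1 / (2 * \<gamma>) * (norm (x - z))\<^sup>2 - (B *v u) \<bullet> x"
        using diff[of x] psd[of "x - p"] assms(2) by linarith
    qed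
    then show ?thesis
      by (simp add: p_def)
  qed
  with bij show ?thesis
    by blast
qed

end
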